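(* Let $f(x)=(1+x)\,\dfrac{x}{\sin x}=\sum_{k\ge0}a_kx^k/k!$ and let $\ddot H_n=\det(a_{2i+j})_{0\le i,j\le n-1}$ for $n\ge1$, $\ddot H_0=1$. Set $$Q(k)=\frac{144\cdot 64^{\,k}\;(k!)^{5}\,\bigl((k+1)!\bigr)^{6}\,(2k)!\,(2k+1)!}{(3k)!\,(3k+3)!\,(3k+4)!}\,.$$ Then the determinants obey the two-step recurrence $\ddot H_{n+2}=\tfrac23\,Q(n)\,\ddot H_{n}$ for all $n\ge0$, and hence, for all $N\ge0$, $$\ddot H_{2N}=\Bigl(\tfrac23\Bigr)^{N}\prod_{k=0}^{N-1}Q(2k), \qquad \ddot H_{2N+1}=\Bigl(\tfrac23\Bigr)^{N}\prod_{k=0}^{N-1}Q(2k+1).$$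
   Context: $x/\sin x$ denotes the even power series with constant term $1$. Empty products equal $1$. *)

theory Defs
  imports
    "HOL-Computational_Algebra.Formal_Power_Series"
    "Jordan_Normal_Form.Determinant"
begin

definition x_over_sin :: "real fps" where
  "x_over_sin = fps_X / fps_sin 1"

text \<open>
  Division of formal power series over a field cancels the common factor \<open>X\<close> of \<open>X\<close> and
  \<open>sin X\<close>, so this quotient is exact.
\<close>

lemma subdegree_fps_sin_1: "subdegree (fps_sin (1::real)) = 1"
  by (rule subdegreeI) (simp_all add: fps_sin_def)

lemma x_over_sin_times_sin: "x_over_sin * fps_sin 1 = fps_X"
proof -
  have "fps_sin (1::real) dvd fps_X"
    by (subst fps_dvd_iff) (auto simp: subdegree_fps_sin_1 dest: arg_cong[where f = subdegree])
  then show ?thesis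
    unfolding x_over_sin_def by (rule dvd_div_mult_self)
qed

lemma x_over_sin_nth_0: "fps_nth x_over_sin 0 = 1"
proof -
  have "fps_nth (x_over_sin * fps_sin 1) 1 = 1"
    by (simp add: x_over_sin_times_sin)
  then show ?thesis
    by (simp add: fps_mult_nth fps_sin_def)
qed

definition f_ser :: "real fps" where
  "f_ser = (1 + fps_X) * x_over_sin"

definition a_coeff :: "nat \<Rightarrow> real" where
  "a_coeff k = fact k * fps_nth f_ser k"

lemma f_ser_eq: "f_ser = Abs_fps (\<lambda>k. a_coeff k / fact k)"
  by (simp add: fps_eq_iff a_coeff_def)

definition H_ddot :: "nat \<Rightarrow> real" where
  "H_ddot n = det (mat n n (\<lambda>(i, j). a_coeff (2 * i + j)))"

lemma H_ddot_0: "H_ddot 0 = 1"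
  by (simp add: H_ddot_def det_dim_zero)

definition Q :: "nat \<Rightarrow> real" where
  "Q k = 144 * 64 ^ k * (fact k) ^ 5 * (fact (k + 1)) ^ 6 * fact (2 * k) * fact (2 * k + 1)
         / (fact (3 * k) * fact (3 * k + 3) * fact (3 * k + 4))"

end

theory Submission
  imports Defs
begin

text \<open>
  Read column \<open>j\<close> of the matrix as values \<open>t\<^sup>i \<mapsto> a\<^sub>2\<^sub>i\<^sub>+\<^sub>j\<close> of a linear functional on polynomials in
  \<open>t = D\<^sup>2\<close>, and pass from the monomials \<open>t\<^sup>i\<close> to the products of \<open>t + (2k + 1)\<^sup>2\<close> over \<open>k < i\<close>. Since
  \<open>D\<^sup>2\<close> maps series \<open>cos x \<cdot> h (sin x)\<close> to series of the same kind, this functional reads off the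
  coefficient of \<open>y\<close> to the power \<open>2 i\<close> in \<open>h\<close>, and the known expansions of
  \<open>arcsin y / sqrt (1 - y\<^sup>2)\<close> and \<open>arcsin\<^sup>2 y\<close> give the columns \<open>j = 0\<close> and \<open>j = 1\<close>: up to
  the row factor \<open>4\<^sup>i (i!)\<^sup>2\<close> they are \<open>1 / (2i + 1)\<close> and \<open>2 / (2i + 2)\<close>. Going from column \<open>j\<close> to
  \<open>j + 2\<close> sends \<open>1 / (2i + c)\<close> to \<open>c\<^sup>2 / (2i + c + 2) - (c - 1)\<^sup>2 / (2i + c)\<close>, so triangular row and
  column operations turn the matrix into the Cauchy matrix with entries \<open>1 / (2i + j + 1)\<close>.
\<close>

subsection \<open>The first two columns\<close>

definition egf_coeff :: "real fps \<Rightarrow> nat \<Rightarrow> real" where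
  "egf_coeff g k = fact k * fps_nth g k"

lemma egf_coeff_deriv: "egf_coeff (fps_deriv g) k = egf_coeff g (Suc k)"
  by (simp add: egf_coeff_def algebra_simps)

text \<open>The coefficient of \<open>t\<^sup>k\<close> in the product of \<open>t + (2m + 1)\<^sup>2\<close> over \<open>m < i\<close>.\<close>

primrec odd_square_coeff :: "nat \<Rightarrow> nat \<Rightarrow> real" where
  "odd_square_coeff 0 k = (if k = 0 then 1 else 0)"
| "odd_square_coeff (Suc i) k =
    (if k = 0 then 0 else odd_square_coeff i (k - 1)) + (2 * real i + 1)\<^sup>2 * odd_square_coeff i k"

definition odd_square_functional :: "nat \<Rightarrow> (nat \<Rightarrow> real) \<Rightarrow> real" where
  "odd_square_functional i a = (\<Sum>k\<le>i. odd_square_coeff i k * a (2 * k))"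

lemma odd_square_coeff_eq_0: "i < k \<Longrightarrow> odd_square_coeff i k = 0"
  by (induction i arbitrary: k) auto

lemma odd_square_coeff_diag: "odd_square_coeff i i = 1"
  by (induction i) (auto simp: odd_square_coeff_eq_0)

lemma odd_square_functional_0 [simp]: "odd_square_functional 0 a = a 0"
  by (simp add: odd_square_functional_def)

text \<open>Multiplication by the new factor \<open>t + (2 i + 1)\<^sup>2\<close>, where
  \<open>t\<close> shifts the sequence by two.\<close>

lemma odd_square_functional_Suc:
  "odd_square_functional (Suc i) a =
    odd_square_functional i (\<lambda>m. a (m + 2)) + (2 * real i + 1)\<^sup>2 * odd_square_functional i a"
proof -
  have "odd_square_functional (Suc i) a =
      (\<Sum>k\<le>Suc i. (if k = 0 then 0 else odd_square_coeff i (k - 1)) * a (2 * k))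
      + (\<Sum>k\<le>Suc i. (2 * real i + 1)\<^sup>2 * odd_square_coeff i k * a (2 * k))"
    unfolding odd_square_functional_def by (simp only: odd_square_coeff.simps sum.distrib distrib_right)
  also have "(\<Sum>k\<le>Suc i. (if k = 0 then 0 else odd_square_coeff i (k - 1)) * a (2 * k)) =
      odd_square_functional i (\<lambda>m. a (m + 2))"
    unfolding odd_square_functional_def by (subst sum.atMost_Suc_shift) simp
  also have "(\<Sum>k\<le>Suc i. (2 * real i + 1)\<^sup>2 * odd_square_coeff i k * a (2 * k)) =
      (2 * real i + 1)\<^sup>2 * odd_square_functional i a"
    by (simp add: odd_square_functional_def odd_square_coeff_eq_0 sum_distrib_left mult.assoc)
  finally show ?thesis .
qed

text \<open>On coefficients the operator on \<open>h\<close> takes \<open>h_n\<close> to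
  \<open>(n + 2) (n + 1) h_(n+2) - (n + 1)\<^sup>2 h_n\<close>.\<close>

lemma deriv_deriv_cos_mult_compose_sin:
  fixes h :: "real fps"
  shows "fps_deriv (fps_deriv (fps_cos 1 * (h oo fps_sin 1))) =
    fps_cos 1 * (((1 - fps_X\<^sup>2) * fps_deriv (fps_deriv h) - 3 * fps_X * fps_deriv h - h) oo fps_sin 1)"
proof -
  let ?s = "fps_sin (1 :: real)" and ?c = "fps_cos (1 :: real)"
  have X: "fps_X oo ?s = ?s"
    by (simp add: fps_X_fps_compose_startby0)
  have three: "(3 :: real fps) oo ?s = 3"
    by (simp add: numeral_fps_const)
  have sq: "?c * ?c = 1 - ?s * ?s"
    using fps_sin_cos_sum_of_squares[of "1 :: real"] by (simp add: power2_eq_square algebra_simps)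
  have "fps_deriv (fps_deriv (?c * (h oo ?s))) =
      ?c * ((?c * ?c) * (fps_deriv (fps_deriv h) oo ?s) - 3 * ?s * (fps_deriv h oo ?s) - (h oo ?s))"
    by (simp add: fps_compose_deriv fps_sin_deriv fps_cos_deriv algebra_simps
        fps_const_neg[symmetric] del: fps_const_neg)
  also have "\<dots> = ?c * (((1 - fps_X\<^sup>2) * fps_deriv (fps_deriv h) - 3 * fps_X * fps_deriv h - h) oo ?s)"
    unfolding sq
    by (simp add: fps_compose_sub_distrib fps_compose_mult_distrib power2_eq_square X three mult.assoc)
  finally show ?thesis .
qed

text \<open>The factor \<open>t + (2 i + 1)\<^sup>2\<close> cancels the diagonal term at
  \<open>n = 2 i\<close>; only \<open>(2 i + 2) (2 i + 1) h_(2i+2)\<close> survives, and these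
  factors build up the factorial.\<close>

lemma odd_square_functional_cos_mult_compose_sin:
  "odd_square_functional i (egf_coeff (fps_cos 1 * (h oo fps_sin 1))) = fact (2 * i) * fps_nth h (2 * i)"
proof (induction i arbitrary: h)
  case 0
  then show ?case by (simp add: egf_coeff_def)
next
  case (Suc i)
  let ?h = "(1 - fps_X\<^sup>2) * fps_deriv (fps_deriv h) - 3 * fps_X * fps_deriv h - h"
  let ?g = "fps_cos 1 * (h oo fps_sin 1)"
  have "(\<lambda>m. egf_coeff ?g (m + 2)) = egf_coeff (fps_deriv (fps_deriv ?g))"
    by (simp add: fun_eq_iff egf_coeff_deriv del: fps_deriv_mult)
  then have eq: "(\<lambda>m. egf_coeff ?g (m + 2)) = egf_coeff (fps_cos 1 * (?h oo fps_sin 1))"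
    by (simp only: deriv_deriv_cos_mult_compose_sin)
  have nth: "fps_nth ?h (2 * i) =
      (2 * real i + 2) * (2 * real i + 1) * fps_nth h (2 * i + 2) - (2 * real i + 1)\<^sup>2 * fps_nth h (2 * i)"
  \<comment> \<open>Multiplying by \<open>fps_X\<close> lowers the index, so index 0 is treated
    separately.\<close>
  proof (cases i)
    case 0
    then show ?thesis
      by (simp add: fps_mult_nth_0 power2_eq_square mult.assoc numeral_fps_const)
  next
    case (Suc j)
    have "fps_nth ?h (2 * i) = fps_nth (fps_deriv (fps_deriv h)) (2 * i)
        - fps_nth (fps_X * (fps_X * fps_deriv (fps_deriv h))) (2 * i)
        - 3 * fps_nth (fps_X * fps_deriv h) (2 * i) - fps_nth h (2 * i)"
      by (simp add: algebra_simps power2_eq_square numeral_fps_const fps_mult_left_const_nth)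
    also have "\<dots> = (2 * real i + 2) * (2 * real i + 1) * fps_nth h (2 * i + 2)
        - (2 * real i + 1)\<^sup>2 * fps_nth h (2 * i)"
      by (simp add: Suc power2_eq_square algebra_simps)
    finally show ?thesis .
  qed
  show ?case
    unfolding odd_square_functional_Suc eq Suc.IH nth
    by (simp add: algebra_simps power2_eq_square)
qed

text \<open>The series of \<open>arcsin y / sqrt (1 - y\<^sup>2)\<close>.\<close>

definition arcsin_div_sqrt :: "real fps" where
  "arcsin_div_sqrt = Abs_fps (\<lambda>n. if odd n then 4 ^ (n div 2) * (fact (n div 2))\<^sup>2 / fact n else 0)"

lemma arcsin_div_sqrt_nth_odd:
  "fps_nth arcsin_div_sqrt (Suc (2 * i)) = 4 ^ i * (fact i)\<^sup>2 / fact (Suc (2 * i))"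
  by (simp add: arcsin_div_sqrt_def)

lemma arcsin_div_sqrt_rec:
  "(real n + 2) * fps_nth arcsin_div_sqrt (n + 2) = (real n + 1) * fps_nth arcsin_div_sqrt n"
proof (cases "odd n")
  case True
  then obtain i where "n = 2 * i + 1" by (elim oddE)
  then have i: "n = Suc (2 * i)" "n + 2 = Suc (2 * Suc i)" by simp_all
  show ?thesis
    unfolding i(2) arcsin_div_sqrt_nth_odd unfolding i(1) arcsin_div_sqrt_nth_odd
    by (simp add: divide_simps power2_eq_square) (simp add: algebra_simps)
qed (simp add: arcsin_div_sqrt_def)

lemma arcsin_div_sqrt_ode:
  "(1 - fps_X\<^sup>2) * fps_deriv arcsin_div_sqrt - fps_X * arcsin_div_sqrt = 1"
proof (rule fps_ext)
  fix n :: nat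
  consider "n = 0" | "n = 1" | m where "n = m + 2"
    by (metis One_nat_def add_2_eq_Suc' not0_implies_Suc)
  then show "fps_nth ((1 - fps_X\<^sup>2) * fps_deriv arcsin_div_sqrt - fps_X * arcsin_div_sqrt) n = fps_nth 1 n"
  proof cases
    case (3 m)
    have "fps_nth ((1 - fps_X\<^sup>2) * fps_deriv arcsin_div_sqrt - fps_X * arcsin_div_sqrt) n =
        fps_nth (fps_deriv arcsin_div_sqrt - fps_X * (fps_X * fps_deriv arcsin_div_sqrt) - fps_X * arcsin_div_sqrt) n"
      by (simp add: algebra_simps power2_eq_square)
    also have "\<dots> = 0"
      using arcsin_div_sqrt_rec[of "m + 1"] by (simp add: 3 algebra_simps)
    finally show ?thesis by (simp add: 3)
  qed (simp_all add: algebra_simps power2_eq_square arcsin_div_sqrt_def)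
qed

lemma fps_sin_1_neq_0: "fps_sin (1 :: real) \<noteq> 0"
  using x_over_sin_times_sin by auto

lemma fps_compose_mult_fps_X:
  fixes b :: "'a :: idom fps"
  assumes "fps_nth b 0 = 0"
  shows "(fps_X * a) oo b = b * (a oo b)"
  using assms by (simp add: fps_compose_mult_distrib fps_X_fps_compose_startby0)

text \<open>Formally \<open>arcsin (sin x) = x\<close>: by the differential equation the left side
  has derivative 1, and its constant term is 0.\<close>

lemma cos_mult_arcsin_div_sqrt_compose_sin:
  "fps_cos 1 * (arcsin_div_sqrt oo fps_sin 1) = fps_X"
proof -
  let ?s = "fps_sin (1 :: real)" and ?c = "fps_cos (1 :: real)" and ?u = arcsin_div_sqrt
  have sq: "?c * ?c = 1 - ?s * ?s"
    using fps_sin_cos_sum_of_squares[of "1 :: real"] by (simp add: power2_eq_square algebra_simps)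
  have "fps_deriv (?c * (?u oo ?s)) = (?c * ?c) * (fps_deriv ?u oo ?s) - ?s * (?u oo ?s)"
    by (simp add: fps_compose_deriv fps_sin_deriv fps_cos_deriv algebra_simps
        fps_const_neg[symmetric] del: fps_const_neg)
  also have "\<dots> = ((1 - fps_X\<^sup>2) * fps_deriv ?u - fps_X * ?u) oo ?s"
    unfolding sq
    by (simp add: fps_compose_sub_distrib fps_compose_mult_distrib power2_eq_square
        fps_X_fps_compose_startby0)
  also have "\<dots> = fps_deriv fps_X"
    by (simp add: arcsin_div_sqrt_ode)
  finally show ?thesis
    unfolding fps_deriv_eq_iff by (simp add: fps_mult_nth_0 arcsin_div_sqrt_def)
qed

lemma x_over_sin_eq: "x_over_sin = fps_cos 1 * (fps_shift 1 arcsin_div_sqrt oo fps_sin 1)"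
proof -
  have "arcsin_div_sqrt = fps_X * fps_shift 1 arcsin_div_sqrt"
    by (rule fps_ext) (simp add: arcsin_div_sqrt_def)
  then have "arcsin_div_sqrt oo fps_sin 1 = fps_sin 1 * (fps_shift 1 arcsin_div_sqrt oo fps_sin 1)"
    by (metis fps_compose_mult_fps_X fps_sin_nth_0)
  with cos_mult_arcsin_div_sqrt_compose_sin x_over_sin_times_sin
  have "x_over_sin * fps_sin 1 = (fps_cos 1 * (fps_shift 1 arcsin_div_sqrt oo fps_sin 1)) * fps_sin 1"
    by (simp add: mult_ac)
  then show ?thesis
    using fps_sin_1_neq_0 by simp
qed

text \<open>The derivative of \<open>arcsin\<^sup>2 y\<close> is \<open>2 arcsin y / sqrt (1 - y\<^sup>2)\<close>; integrate and divide by \<open>y\<close>.\<close>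

definition arcsin_square_div_X :: "real fps" where
  "arcsin_square_div_X = Abs_fps (\<lambda>n. 2 * fps_nth arcsin_div_sqrt n / (real n + 1))"

lemma deriv_X_mult_x_over_sin_eq:
  "fps_deriv (fps_X * x_over_sin) = fps_cos 1 * (fps_deriv arcsin_square_div_X oo fps_sin 1)"
proof -
  let ?s = "fps_sin (1 :: real)" and ?c = "fps_cos (1 :: real)" and ?v = arcsin_square_div_X
  have "fps_deriv (fps_X * ?v) = 2 * arcsin_div_sqrt"
    by (rule fps_ext)
       (simp add: arcsin_square_div_X_def numeral_fps_const fps_mult_left_const_nth field_simps
         del: fps_deriv_mult)
  moreover have "(2 * arcsin_div_sqrt) oo ?s = 2 * (arcsin_div_sqrt oo ?s)"
    by (simp add: fps_compose_mult_distrib numeral_fps_const)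
  ultimately have "fps_deriv ((fps_X * ?v) oo ?s) = 2 * (?c * (arcsin_div_sqrt oo ?s))"
    by (simp add: fps_compose_deriv fps_sin_deriv mult_ac del: fps_deriv_mult)
  also have "\<dots> = fps_deriv (fps_X * fps_X)"
    by (simp add: cos_mult_arcsin_div_sqrt_compose_sin)
  \<comment> \<open>This is \<open>arcsin\<^sup>2 (sin x) = x\<^sup>2\<close>; dividing by
    \<open>sin x\<close> and differentiating produces the factor \<open>cos x\<close>.\<close>
  finally have "(fps_X * ?v) oo ?s = fps_X * fps_X"
    unfolding fps_deriv_eq_iff by simp
  then have "?s * (?v oo ?s) = (fps_X * x_over_sin) * ?s"
    by (simp add: fps_compose_mult_fps_X mult.assoc x_over_sin_times_sin)
  then have "fps_X * x_over_sin = ?v oo ?s"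
    using fps_sin_1_neq_0 by (simp add: mult.commute)
  then show ?thesis
    by (simp add: fps_compose_deriv fps_sin_deriv mult.commute del: fps_deriv_mult)
qed

text \<open>Both \<open>x\<close> and \<open>sin x\<close> are odd, so the substitution of
  \<open>-x\<close> fixes the quotient.\<close>

lemma x_over_sin_nth_odd: "odd n \<Longrightarrow> fps_nth x_over_sin n = 0"
proof -
  assume n: "odd n"
  have s: "fps_sin (1::real) oo fps_const (- 1) * fps_X = - fps_sin 1"
    by (rule fps_ext) (simp add: fps_sin_def del: fps_const_neg)
  have "(x_over_sin oo fps_const (- 1) * fps_X) * fps_sin 1 =
      - ((x_over_sin * fps_sin 1) oo fps_const (- 1) * fps_X)"
    by (simp add: fps_compose_mult_distrib s del: fps_const_neg)
  also have "\<dots> = x_over_sin * fps_sin 1"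
    by (simp add: x_over_sin_times_sin fps_X_fps_compose_startby0 fps_const_neg[symmetric]
        del: fps_const_neg)
  finally have "x_over_sin oo fps_const (- 1) * fps_X = x_over_sin"
    using fps_sin_1_neq_0 by simp
  then have "fps_nth (x_over_sin oo fps_const (- 1) * fps_X) n = fps_nth x_over_sin n"
    by simp
  with n show ?thesis
    by (simp del: fps_const_neg)
qed

text \<open>Only entries of even index matter, so the odd part of a series may be dropped.\<close>

lemma odd_square_functional_cong:
  "(\<And>k. a (2 * k) = b (2 * k)) \<Longrightarrow> odd_square_functional i a = odd_square_functional i b"
  by (simp add: odd_square_functional_def)

lemma odd_square_functional_a_coeff:
  "odd_square_functional i a_coeff = 4 ^ i * (fact i)\<^sup>2 / (2 * real i + 1)"
proof -
  have "a_coeff (2 * k) = egf_coeff x_over_sin (2 * k)" for k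
    by (cases k) (simp_all add: a_coeff_def egf_coeff_def f_ser_def distrib_right x_over_sin_nth_odd)
  then have "odd_square_functional i a_coeff = odd_square_functional i (egf_coeff x_over_sin)"
    by (rule odd_square_functional_cong)
  also have "\<dots> = fact (2 * i) * fps_nth arcsin_div_sqrt (Suc (2 * i))"
    by (subst x_over_sin_eq) (simp add: odd_square_functional_cos_mult_compose_sin)
  finally show ?thesis
    unfolding arcsin_div_sqrt_nth_odd by (simp add: divide_simps) (simp add: algebra_simps)
qed

text \<open>Odd-index coefficients of \<open>f_ser\<close> come from
  \<open>fps_X * x_over_sin\<close> alone; differentiating moves them to even indices.\<close>

lemma odd_square_functional_a_coeff_Suc:
  "odd_square_functional i (\<lambda>m. a_coeff (Suc m)) = 4 ^ i * (fact i)\<^sup>2 / (real i + 1)"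
proof -
  have "a_coeff (Suc (2 * k)) = egf_coeff (fps_deriv (fps_X * x_over_sin)) (2 * k)" for k
    by (simp add: a_coeff_def egf_coeff_def egf_coeff_deriv f_ser_def algebra_simps x_over_sin_nth_odd
        del: fps_deriv_mult)
  then have "odd_square_functional i (\<lambda>m. a_coeff (Suc m)) =
      odd_square_functional i (egf_coeff (fps_deriv (fps_X * x_over_sin)))"
    by (rule odd_square_functional_cong)
  also have "\<dots> = fact (2 * i) * fps_nth (fps_deriv arcsin_square_div_X) (2 * i)"
    by (simp add: deriv_X_mult_x_over_sin_eq odd_square_functional_cos_mult_compose_sin
        del: fps_deriv_mult)
  also have "\<dots> = fact (2 * i) * (2 * real i + 1) * fps_nth arcsin_div_sqrt (Suc (2 * i)) / (real i + 1)"
    by (simp add: arcsin_square_div_X_def divide_simps) (simp add: algebra_simps)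
  also have "\<dots> = 4 ^ i * (fact i)\<^sup>2 / (real i + 1)"
    unfolding arcsin_div_sqrt_nth_odd by (simp add: divide_simps)
  finally show ?thesis .
qed

subsection \<open>Cauchy determinants\<close>

lemma mat_mult_mat:
  "mat n m A * mat m k B = mat n k (\<lambda>(i, j). \<Sum>l<m. A (i, l) * B (l, j))"
  by (rule eq_matI) (auto simp: scalar_prod_def atLeast0LessThan intro!: sum.cong)

lemma det_mat_lower_triangular:
  assumes "\<And>i j. i < j \<Longrightarrow> j < n \<Longrightarrow> A (i, j) = 0"
  shows "det (mat n n A) = (\<Prod>i<n. A (i, i))"
  using assms by (subst det_lower_triangular[of n]) (auto simp: prod_list_diag_prod atLeast0LessThan)

lemma det_mat_upper_triangular:
  assumes "\<And>i j. j < i \<Longrightarrow> i < n \<Longrightarrow> A (i, j) = 0"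
  shows "det (mat n n A) = (\<Prod>i<n. A (i, i))"
  using assms by (subst det_upper_triangular[of _ n])
    (auto simp: prod_list_diag_prod atLeast0LessThan intro!: upper_triangularI)

text \<open>Each term of the Leibniz expansion contains every row factor and every column factor
  exactly once.\<close>

lemma det_scale_rows_cols:
  fixes A :: "nat \<times> nat \<Rightarrow> 'a :: comm_ring_1"
  shows "det (mat n n (\<lambda>(i, j). r i * A (i, j) * c j)) = (\<Prod>i<n. r i) * (\<Prod>j<n. c j) * det (mat n n A)"
proof -
  have "det (mat n n (\<lambda>(i, j). r i * A (i, j) * c j)) =
      (\<Sum>p | p permutes {0..<n}. signof p * (\<Prod>i = 0..<n. r i * A (i, p i) * c (p i)))"
    by (subst det_def'[of _ n]) (auto intro!: sum.cong prod.cong dest: permutes_in_image)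
  also have "\<dots> = (\<Sum>p | p permutes {0..<n}.
      (\<Prod>i<n. r i) * (\<Prod>j<n. c j) * (signof p * (\<Prod>i = 0..<n. A (i, p i))))"
  proof (rule sum.cong[OF refl])
    fix p assume "p \<in> {p. p permutes {0..<n}}"
    then have "(\<Prod>i = 0..<n. c (p i)) = (\<Prod>j = 0..<n. c j)"
      using prod.permute[of p "{0..<n}" c] by (simp add: o_def)
    then show "signof p * (\<Prod>i = 0..<n. r i * A (i, p i) * c (p i)) =
        (\<Prod>i<n. r i) * (\<Prod>j<n. c j) * (signof p * (\<Prod>i = 0..<n. A (i, p i)))"
      by (simp add: prod.distrib atLeast0LessThan mult_ac)
  qed
  also have "\<dots> = (\<Prod>i<n. r i) * (\<Prod>j<n. c j) * det (mat n n A)"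
    by (subst det_def'[of "mat n n A" n])
       (auto simp: sum_distrib_left intro!: sum.cong prod.cong dest: permutes_in_image)
  finally show ?thesis .
qed

lemma det_Schur_complement:
  fixes A :: "nat \<times> nat \<Rightarrow> 'a :: field"
  assumes d: "A (n, n) \<noteq> 0"
  shows "det (mat (Suc n) (Suc n) A) =
    A (n, n) * det (mat n n (\<lambda>(i, j). A (i, j) - A (i, n) * A (n, j) / A (n, n)))"
proof -
  define S where "S = (\<lambda>(i, j). A (i, j) - A (i, n) * A (n, j) / A (n, n))"
  define P where "P = (\<lambda>(i, j). if j = n then A (i, n) else if i = n then 0 else S (i, j))"
  define L where "L = (\<lambda>(i, j). if i = j then 1 else if i = n then A (n, j) / A (n, n) else 0)"
  \<comment> \<open>Column elimination with pivot \<open>A (n, n)\<close>: \<open>P\<close> is block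
    upper triangular with blocks \<open>S\<close> and the pivot, and \<open>L\<close> is unit lower
    triangular.\<close>
  have "mat (Suc n) (Suc n) A = mat (Suc n) (Suc n) P * mat (Suc n) (Suc n) L"
    unfolding mat_mult_mat
  proof (rule cong_mat[OF refl refl])
    fix i j assume ij: "i < Suc n" "j < Suc n"
    have "(\<Sum>l<Suc n. P (i, l) * L (l, j)) = (\<Sum>l<n. P (i, l) * L (l, j)) + P (i, n) * L (n, j)"
      by simp
    also have "(\<Sum>l<n. P (i, l) * L (l, j)) = (\<Sum>l<n. if l = j then P (i, l) else 0)"
      by (rule sum.cong) (auto simp: L_def)
    also have "\<dots> = (if j < n then P (i, j) else 0)"
      by simp
    also have "\<dots> + P (i, n) * L (n, j) = A (i, j)"
      using ij d by (auto simp: P_def L_def S_def less_Suc_eq)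
    finally show "A (i, j) = (case (i, j) of (i, j) \<Rightarrow> \<Sum>l<Suc n. P (i, l) * L (l, j))"
      by simp
  qed
  then have "det (mat (Suc n) (Suc n) A) = det (mat (Suc n) (Suc n) P) * det (mat (Suc n) (Suc n) L)"
    by (simp add: det_mult[of _ "Suc n"])
  moreover have "det (mat (Suc n) (Suc n) L) = 1"
    by (subst det_mat_lower_triangular) (auto simp: L_def)
  moreover have "mat (Suc n) (Suc n) P =
      four_block_mat (mat n n S) (mat n 1 (\<lambda>(i, j). A (i, n))) (0\<^sub>m 1 n) (mat 1 1 (\<lambda>_. A (n, n)))"
    by (rule eq_matI) (auto simp: P_def less_Suc_eq four_block_mat_def)
  then have "det (mat (Suc n) (Suc n) P) = det (mat n n S) * A (n, n)"
    by (simp add: det_four_block_mat_lower_left_zero[of _ n _ 1] det_single)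
  ultimately show ?thesis
    by (simp add: S_def)
qed

text \<open>The Schur complement of a Cauchy matrix is the smaller Cauchy matrix with rescaled rows
  and columns.\<close>

lemma det_Cauchy_Suc:
  fixes x y :: "nat \<Rightarrow> 'a :: field"
  assumes nz: "\<And>i j. i \<le> n \<Longrightarrow> j \<le> n \<Longrightarrow> x i + y j \<noteq> 0"
  shows "det (mat (Suc n) (Suc n) (\<lambda>(i, j). 1 / (x i + y j))) =
    (\<Prod>i<n. (x i - x n) / (x i + y n)) * (\<Prod>j<n. (y j - y n) / (x n + y j)) / (x n + y n)
    * det (mat n n (\<lambda>(i, j). 1 / (x i + y j)))"
proof -
  have eq: "mat n n (\<lambda>(i, j). 1 / (x i + y j) - (x n + y n) / ((x i + y n) * (x n + y j))) =
      mat n n (\<lambda>(i, j). (x i - x n) / (x i + y n) * (1 / (x i + y j)) * ((y j - y n) / (x n + y j)))"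
  proof (rule cong_mat[OF refl refl])
    fix i j assume "i < n" "j < n"
    then have "x i + y j \<noteq> 0" "x i + y n \<noteq> 0" "x n + y j \<noteq> 0" "x n + y n \<noteq> 0"
      using nz by simp_all
    then show "(case (i, j) of (i, j) \<Rightarrow>
          1 / (x i + y j) - (x n + y n) / ((x i + y n) * (x n + y j))) =
        (case (i, j) of (i, j) \<Rightarrow> (x i - x n) / (x i + y n) * (1 / (x i + y j)) * ((y j - y n) / (x n + y j)))"
      by (simp add: divide_simps) (simp add: algebra_simps)
  qed
  have "det (mat n n (\<lambda>(i, j). 1 / (x i + y j) - (x n + y n) / ((x i + y n) * (x n + y j)))) =
      (\<Prod>i<n. (x i - x n) / (x i + y n)) * (\<Prod>j<n. (y j - y n) / (x n + y j))
      * det (mat n n (\<lambda>(i, j). 1 / (x i + y j)))"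
    unfolding eq
    using det_scale_rows_cols[of n "\<lambda>i. (x i - x n) / (x i + y n)" "\<lambda>(i, j). 1 / (x i + y j)"
        "\<lambda>j. (y j - y n) / (x n + y j)"]
    by simp
  then show ?thesis
    using nz[of n n] by (subst det_Schur_complement) simp_all
qed

subsection \<open>Reduction to a Cauchy determinant\<close>

text \<open>
  The coefficients of the columns in terms of the Cauchy columns \<open>1 / (2i + k + 1)\<close>; the
  recursion is the column step with \<open>c = k + 1\<close>.
\<close>

fun cauchy_coeff :: "nat \<Rightarrow> nat \<Rightarrow> real" where
  "cauchy_coeff 0 k = (if k = 0 then 1 else 0)"
| "cauchy_coeff (Suc 0) k = (if k = 1 then 2 else 0)"
| "cauchy_coeff (Suc (Suc j)) k =
    (if k < 2 then 0 else (real k - 1)\<^sup>2 * cauchy_coeff j (k - 2)) - (real k)\<^sup>2 * cauchy_coeff j k"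

lemma cauchy_coeff_eq_0: "j < k \<Longrightarrow> cauchy_coeff j k = 0"
  by (induction j k rule: cauchy_coeff.induct) auto

lemma cauchy_coeff_le: "cauchy_coeff j k \<noteq> 0 \<Longrightarrow> k \<le> j"
  by (meson cauchy_coeff_eq_0 not_le)

lemma cauchy_coeff_diag_Suc_Suc:
  "cauchy_coeff (Suc (Suc j)) (Suc (Suc j)) = (real j + 1)\<^sup>2 * cauchy_coeff j j"
  by (simp add: cauchy_coeff_eq_0 algebra_simps)

text \<open>The diagonal entries advance in steps of two, with a pattern depending on parity;
  neighbouring ones multiply to a closed form.\<close>

lemma cauchy_coeff_diag_mult:
  "cauchy_coeff j j * cauchy_coeff (Suc j) (Suc j) = 2 * (fact j)\<^sup>2"
proof (induction j)
  case (Suc j)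
  have "cauchy_coeff (Suc j) (Suc j) * cauchy_coeff (Suc (Suc j)) (Suc (Suc j)) =
      (real j + 1)\<^sup>2 * (cauchy_coeff j j * cauchy_coeff (Suc j) (Suc j))"
    unfolding cauchy_coeff_diag_Suc_Suc by (simp only: mult_ac)
  then show ?case
    unfolding Suc.IH by (simp add: power2_eq_square algebra_simps)
qed simp

lemma odd_square_functional_a_coeff_shift:
  "odd_square_functional i (\<lambda>m. a_coeff (m + j)) =
    4 ^ i * (fact i)\<^sup>2 * (\<Sum>k\<le>j. cauchy_coeff j k / (2 * real i + (real k + 1)))"
proof (induction j arbitrary: i rule: induct_nat_012)
  case 0
  then show ?case
    by (simp add: odd_square_functional_a_coeff)
next
  case 1
  then show ?case
    by (simp add: odd_square_functional_a_coeff_Suc divide_simps)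
next
  case (ge2 j)
  let ?c = "cauchy_coeff j"
  \<comment> \<open>Division with remainder in \<open>2 i\<close>: both fractions on the left have
    polynomial part \<open>2 i + 1 - k\<close>, so only the remainders are left.\<close>
  have step: "(2 * real i + 2)\<^sup>2 / (2 * real i + (real k + 3)) - (2 * real i + 1)\<^sup>2 / (2 * real i + (real k + 1))
      = (real k + 1)\<^sup>2 / (2 * real i + (real k + 3)) - (real k)\<^sup>2 / (2 * real i + (real k + 1))" for k
  proof -
    have "2 * real i + (real k + 3) \<noteq> 0" "2 * real i + (real k + 1) \<noteq> 0"
      by (simp_all add: add_nonneg_eq_0_iff)
    then show ?thesis
      by (simp add: divide_simps) (simp add: algebra_simps power2_eq_square)
  qed
  \<comment> \<open>The product recursion, solved for the shifted sequence, trades two columns for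
    one row.\<close>
  have "odd_square_functional i (\<lambda>m. a_coeff (m + Suc (Suc j))) =
      odd_square_functional (Suc i) (\<lambda>m. a_coeff (m + j))
      - (2 * real i + 1)\<^sup>2 * odd_square_functional i (\<lambda>m. a_coeff (m + j))"
    by (simp add: odd_square_functional_Suc)
  also have "\<dots> = 4 ^ i * (fact i)\<^sup>2 * ((2 * real i + 2)\<^sup>2 * (\<Sum>k\<le>j. ?c k / (2 * real i + (real k + 3)))
      - (2 * real i + 1)\<^sup>2 * (\<Sum>k\<le>j. ?c k / (2 * real i + (real k + 1))))"
    unfolding ge2.IH(1) by (simp add: power2_eq_square algebra_simps)
  also have "(2 * real i + 2)\<^sup>2 * (\<Sum>k\<le>j. ?c k / (2 * real i + (real k + 3)))
      - (2 * real i + 1)\<^sup>2 * (\<Sum>k\<le>j. ?c k / (2 * real i + (real k + 1))) =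
      (\<Sum>k\<le>j. ?c k * ((2 * real i + 2)\<^sup>2 / (2 * real i + (real k + 3))
        - (2 * real i + 1)\<^sup>2 / (2 * real i + (real k + 1))))"
    by (simp add: sum_distrib_left sum_subtractf right_diff_distrib mult_ac)
  also have "\<dots> = (\<Sum>k\<le>j. (real k + 1)\<^sup>2 * ?c k / (2 * real i + (real k + 3)))
      - (\<Sum>k\<le>j. (real k)\<^sup>2 * ?c k / (2 * real i + (real k + 1)))"
    unfolding step by (simp add: sum_subtractf right_diff_distrib mult_ac)
  also have "(\<Sum>k\<le>j. (real k)\<^sup>2 * ?c k / (2 * real i + (real k + 1))) =
      (\<Sum>k\<le>Suc (Suc j). (real k)\<^sup>2 * ?c k / (2 * real i + (real k + 1)))"
    by (simp add: cauchy_coeff_eq_0)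
  \<comment> \<open>Reindexing by \<open>k + 2\<close> brings both sums over the same
    denominators.\<close>
  also have "(\<Sum>k\<le>j. (real k + 1)\<^sup>2 * ?c k / (2 * real i + (real k + 3))) =
      (\<Sum>k\<le>Suc (Suc j). (if k < 2 then 0 else (real k - 1)\<^sup>2 * ?c (k - 2)) / (2 * real i + (real k + 1)))"
    by (simp add: sum.atMost_Suc_shift del: sum.atMost_Suc) (simp add: add_ac)
  finally show ?case
    by (simp add: sum_subtractf diff_divide_distrib del: sum.atMost_Suc)
qed

text \<open>Determinants are compared in \<open>?L * ?M\<close>, which is \<open>?C * ?U\<close>
  with rows scaled by \<open>r\<close>; \<open>?L\<close> is unit lower and \<open>?U\<close> upper
  triangular.\<close>

lemma H_ddot_eq_det_Cauchy:
  "H_ddot n = (\<Prod>i<n. 4 ^ i * (fact i)\<^sup>2 * cauchy_coeff i i)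
    * det (mat n n (\<lambda>(i, j). 1 / (2 * real i + (real j + 1))))"
proof -
  define r :: "nat \<Rightarrow> real" where "r i = 4 ^ i * (fact i)\<^sup>2" for i
  let ?L = "mat n n (\<lambda>(i, k). odd_square_coeff i k)"
  let ?M = "mat n n (\<lambda>(i, j). a_coeff (2 * i + j))"
  let ?R = "mat n n (\<lambda>(i, j). if i = j then r i else 0)"
  let ?C = "mat n n (\<lambda>(i, j). 1 / (2 * real i + (real j + 1)))"
  let ?U = "mat n n (\<lambda>(k, j). cauchy_coeff j k)"
  have LM: "?L * ?M = mat n n (\<lambda>(i, j). odd_square_functional i (\<lambda>m. a_coeff (m + j)))"
    unfolding mat_mult_mat odd_square_functional_def
    by (rule cong_mat) (auto intro!: sum.mono_neutral_right odd_square_coeff_eq_0)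
  have CU: "?C * ?U = mat n n (\<lambda>(i, j). \<Sum>k\<le>j. cauchy_coeff j k / (2 * real i + (real k + 1)))"
    unfolding mat_mult_mat
    by (rule cong_mat) (auto intro!: sum.mono_neutral_cong_right dest: cauchy_coeff_le)
  have "?L * ?M = mat n n (\<lambda>(i, j). r i * (\<Sum>k\<le>j. cauchy_coeff j k / (2 * real i + (real k + 1))) * 1)"
    unfolding LM odd_square_functional_a_coeff_shift r_def by simp
  then have "det (?L * ?M) = (\<Prod>i<n. r i) * det (?C * ?U)"
    unfolding CU
    using det_scale_rows_cols[of n r "\<lambda>(i, j). \<Sum>k\<le>j. cauchy_coeff j k / (2 * real i + (real k + 1))" "\<lambda>_. 1"]
    by simp
  moreover have "det ?L = 1"
    by (subst det_mat_lower_triangular) (auto simp: odd_square_coeff_eq_0 odd_square_coeff_diag)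
  moreover have "det ?U = (\<Prod>i<n. cauchy_coeff i i)"
    by (subst det_mat_upper_triangular) (auto simp: cauchy_coeff_eq_0)
  ultimately show ?thesis
    by (simp add: H_ddot_def det_mult[of _ n] r_def prod.distrib)
qed

section \<open>One-step and two-step ratios of the determinants\<close>

lemma H_ddot_Suc:
  "H_ddot (Suc n) = 4 ^ n * (fact n)\<^sup>2 * cauchy_coeff n n * 2 ^ n * (fact n)\<^sup>2 * fact (2 * n)
    / ((\<Prod>i<n. 2 * real i + (real n + 1)) * fact (3 * n + 1)) * H_ddot n"
proof -
  have nz: "2 * real i + (real j + 1) \<noteq> 0" for i j
    by (simp add: add_nonneg_eq_0_iff)
  have "(\<Prod>j<m. real m - real j) = fact m" for m
    by (induction m) (auto simp: prod.lessThan_Suc_shift algebra_simps simp del: prod.lessThan_Suc)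
  then have neg: "(\<Prod>j<m. real j - real m) = (- 1) ^ m * fact m" for m
    using prod.distrib[of "\<lambda>_. - 1" "\<lambda>j. real m - real j" "{..<m}"] by simp
  have neg2: "(\<Prod>j<m. 2 * real j - 2 * real m) = 2 ^ m * ((- 1) ^ m * fact m)" for m
    using prod.distrib[of "\<lambda>_. 2" "\<lambda>j. real j - real m" "{..<m}"] by (simp add: neg algebra_simps)
  have asc: "(\<Prod>j<m. real k + (real j + 1)) = fact (k + m) / fact k" for k m
    by (induction m) (simp_all add: add_ac)
  have "(\<Prod>j<n. real (2 * n) + (real j + 1)) = fact (2 * n + n) / fact (2 * n)"
    by (rule asc)
  \<comment> \<open>The corner denominator \<open>3 n + 1\<close> completes the run from
    \<open>2 n + 1\<close> to \<open>3 n\<close>.\<close>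
  then have asc': "(\<Prod>j<n. 2 * real n + (real j + 1)) * (2 * real n + (real n + 1)) =
      fact (3 * n + 1) / fact (2 * n)"
    by (simp add: field_simps)
  have rows: "(\<Prod>i<n. (2 * real i - 2 * real n) / (2 * real i + (real n + 1))) =
      2 ^ n * ((- 1) ^ n * fact n) / (\<Prod>i<n. 2 * real i + (real n + 1))"
    by (simp only: prod_dividef neg2)
  have cols: "(\<Prod>j<n. ((real j + 1) - (real n + 1)) / (2 * real n + (real j + 1))) =
      (- 1) ^ n * fact n / (\<Prod>j<n. 2 * real n + (real j + 1))"
    by (simp add: prod_dividef neg)
  have "det (mat (Suc n) (Suc n) (\<lambda>(i, j). 1 / (2 * real i + (real j + 1)))) =
      2 ^ n * (fact n)\<^sup>2 / ((\<Prod>i<n. 2 * real i + (real n + 1))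
        * ((\<Prod>j<n. 2 * real n + (real j + 1)) * (2 * real n + (real n + 1))))
      * det (mat n n (\<lambda>(i, j). 1 / (2 * real i + (real j + 1))))"
    \<comment> \<open>The signs \<open>(- 1) ^ n\<close> from rows and columns cancel.\<close>
    unfolding det_Cauchy_Suc[OF nz] rows cols by (simp add: power2_eq_square mult_ac)
  then show ?thesis
    unfolding H_ddot_eq_det_Cauchy[of "Suc n"] H_ddot_eq_det_Cauchy[of n] asc'
    by (simp add: mult_ac)
qed

text \<open>
  Each single-step ratio contains a product over every second integer; the two consecutive ones
  interleave to a quotient of factorials, which is why only the two-step ratio is a closed form.
\<close>

lemma prod_alternating_fact:
  "(\<Prod>i<m. 2 * real i + (real k + 1)) * (\<Prod>i<m. 2 * real i + (real k + 2)) = fact (k + 2 * m) / fact k"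
proof (induction m)
  case (Suc m)
  have "(\<Prod>i<Suc m. 2 * real i + (real k + 1)) * (\<Prod>i<Suc m. 2 * real i + (real k + 2)) =
      ((\<Prod>i<m. 2 * real i + (real k + 1)) * (\<Prod>i<m. 2 * real i + (real k + 2)))
      * ((2 * real m + (real k + 1)) * (2 * real m + (real k + 2)))"
    by (simp only: prod.lessThan_Suc mult_ac)
  also have "\<dots> = fact (k + 2 * Suc m) / fact k"
    unfolding Suc.IH by (simp add: divide_simps) (simp add: algebra_simps)
  finally show ?case .
qed simp

lemma H_ddot_Suc_Suc: "H_ddot (n + 2) = 2 / 3 * Q n * H_ddot n"
proof -
  define P where "P m = (\<Prod>i<m. 2 * real i + (real m + 1))" for m
  define t :: "nat \<Rightarrow> real" where "t m = 4 ^ m * (fact m)\<^sup>2 * 2 ^ m * (fact m)\<^sup>2 * fact (2 * m) / fact (3 * m + 1)" for m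
  have "P (Suc n) = (\<Prod>i<n. 2 * real i + (real n + 2)) * (3 * real n + 2)"
    by (simp add: P_def add_ac)
  then have P: "P n * P (Suc n) = fact (3 * n) * (3 * real n + 2) / fact n"
    using prod_alternating_fact[of n n] unfolding P_def[of n]
    by (simp add: mult.assoc[symmetric])
  have step: "H_ddot (Suc m) = t m * cauchy_coeff m m / P m * H_ddot m" for m
    unfolding H_ddot_Suc t_def P_def by (simp add: mult_ac)
  have "H_ddot (n + 2) = t n * t (Suc n) * (cauchy_coeff n n * cauchy_coeff (Suc n) (Suc n))
      / (P n * P (Suc n)) * H_ddot n"
    by (simp add: step mult_ac)
  also have "\<dots> = t n * t (Suc n) * (2 * (fact n)\<^sup>2) / (fact (3 * n) * (3 * real n + 2) / fact n) * H_ddot n"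
    unfolding cauchy_coeff_diag_mult P ..
  also have "t n * t (Suc n) * (2 * (fact n)\<^sup>2) / (fact (3 * n) * (3 * real n + 2) / fact n) = 2 / 3 * Q n"
  proof -
    have p: "(4 :: real) ^ n * 2 ^ n * (4 ^ Suc n * 2 ^ Suc n) = 8 * 64 ^ n"
      by (simp flip: power_mult_distrib)
    \<comment> \<open>Factorials are rewritten only as far as matching \<open>Q n\<close> requires;
      \<open>fact (3 * n + 4)\<close> occurs there as it stands.\<close>
    have f: "(fact (2 * Suc n) :: real) = 2 * (real n + 1) * fact (2 * n + 1)"
      "(fact (3 * n + 3) :: real) = 3 * (real n + 1) * (3 * real n + 2) * fact (3 * n + 1)"
      "(fact (n + 1) :: real) = (real n + 1) * fact n"
      "(fact (3 * Suc n + 1) :: real) = fact (3 * n + 4)"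
      by (simp_all add: fact_reduce algebra_simps)
    have tt: "t n * t (Suc n) = (4 ^ n * 2 ^ n * (4 ^ Suc n * 2 ^ Suc n)) * fact n ^ 4 * fact (n + 1) ^ 4
        * fact (2 * n) * fact (2 * Suc n) / (fact (3 * n + 1) * fact (3 * Suc n + 1))"
      by (simp only: t_def times_divide_times_eq) (simp add: power2_eq_square power4_eq_xxxx mult_ac)
    show ?thesis
      unfolding tt p f Q_def
      by (simp add: divide_simps power_mult_distrib) (simp add: eval_nat_numeral algebra_simps)
  qed
  finally show ?thesis .
qed

theorem theorem18p1:
  shows "(\<forall>n. H_ddot (n + 2) = 2 / 3 * Q n * H_ddot n)
    \<and> (\<forall>N. H_ddot (2 * N) = (2 / 3) ^ N * (\<Prod>k<N. Q (2 * k)))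
    \<and> (\<forall>N. H_ddot (2 * N + 1) = (2 / 3) ^ N * (\<Prod>k<N. Q (2 * k + 1)))"
proof (intro conjI allI)
  show "H_ddot (n + 2) = 2 / 3 * Q n * H_ddot n" for n
    by (rule H_ddot_Suc_Suc)
  show "H_ddot (2 * N) = (2 / 3) ^ N * (\<Prod>k<N. Q (2 * k))" for N
  proof (induction N)
    case (Suc N)
    then show ?case
      using H_ddot_Suc_Suc[of "2 * N"] by simp
  qed (simp add: H_ddot_0)
  show "H_ddot (2 * N + 1) = (2 / 3) ^ N * (\<Prod>k<N. Q (2 * k + 1))" for N
  proof (induction N)
    case (Suc N)
    then show ?case
      using H_ddot_Suc_Suc[of "2 * N + 1"] by simp
  \<comment> \<open>The base value \<open>H_ddot 1 = 1\<close> is the one-step ratio at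
    \<open>n = 0\<close>.\<close>
  qed (simp add: H_ddot_Suc H_ddot_0)
qed

end
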